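(* Let $\beta,\lambda\in\mathbb{R}$. If the product manifold $\mathbb{R}^2\times\mathbb{S}^2$ of $(\mathbb{R}^2,g^R)$ and $(\mathbb{S}^2,g^S)$, where $g^R,g^S$ are the canonical metrics of constant scalar curvature $0,2$ respectively, equipped with the product metric $g$, admits a gradient $\omega$-Bach soliton with potential function $\mathcal{G}=\mathcal{G}(s,t,u,v)$, then $\mathcal{G}$ is given by $$\mathcal{G}=\frac12\Big[\big(\lambda-\tfrac13\big)+\beta P_1^2\Big]s^2+\frac12\Big[\big(\lambda-\tfrac13\big)+\beta P_2^2\Big]t^2+\beta P_1P_2\,st+c_1's+c_2't+\frac{\beta P_3^2}{2}(1+u^2+v^2)^2+c',$$ where $c_1',c_2',c'$ are arbitrary constants and $\omega(X)=g(X,P)$ with $P=P_1\frac{\partial}{\partial s}+P_2\frac{\partial}{\partial t}+P_3\frac{\partial}{\partial u}+P_4\frac{\partial}{\partial v}$, $P_i\in\mathbb{R}$ for all $i\in\{1,\dots,4\}$ and $P_3^2=P_4^2$.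
   Context: $(s,t)$ are the standard coordinates on $\mathbb{R}^2$ with flat metric $g^R$, and $(u,v)\in\mathbb{R}^2$ are stereographic coordinates on $\mathbb{S}^2$ (minus a pole). For $\beta\in\mathbb{R}$ and a vector field $P$ with associated $1$-form $\omega(X)=g(X,P)$, the $\omega$-Bach tensor is $B_\omega=B-\beta\,\omega\otimes\omega$, where $B$ is the Bach tensor of $g$. The normalization of $B$ here is the following: for a product of two surfaces $(\Sigma_1,g_1)$, $(\Sigma_2,g_2)$ with constant scalar curvatures $r_1,r_2$, $B=-\frac1{12}(r_1^2-r_2^2)g_1$ on $\Sigma_1$, $B=-\frac{1}{12}(r_2^2-r_1^2)g_2$ on $\Sigma_2$, with zero mixed components; in particular on $\mathbb{R}^2\times\mathbb{S}^2$, $B=\frac13g^R$ on $\mathbb{R}^2$ and $B=-\frac13g^S$ on $\mathbb{S}^2$. A gradient $\omega$-Bach soliton with potential function $\mathcal{G}$ (and constant $\lambda\in\mathbb{R}$) is a Riemannian manifold with a smooth function $\mathcal{G}$ satisfying $\nabla_i\nabla_j\mathcal{G}+(B_\omega)_{ij}=\lambda g_{ij}$, with $\nabla_i\nabla_j\mathcal{G}$ the Hessian. *)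

theory Defs
  imports "HOL-Analysis.Analysis"
begin

text \<open>
  Tensor calculus in one global chart \<open>real ^ 'n\<close>.  A metric is given by its matrix of components
  \<open>g :: real ^ 'n \<Rightarrow> real ^ 'n ^ 'n\<close>; the definitions are meant for \<open>g\<close> smooth, symmetric and
  positive definite.
\<close>

definition pd :: "'n::finite \<Rightarrow> (real ^ 'n \<Rightarrow> real) \<Rightarrow> real ^ 'n \<Rightarrow> real" where
  "pd i f x = deriv (\<lambda>h. f (x + h *\<^sub>R axis i 1)) 0"

definition smooth_fun :: "(real ^ 'n::finite \<Rightarrow> real) \<Rightarrow> bool" where
  "smooth_fun f \<longleftrightarrow> (\<forall>ms. foldr pd ms f differentiable_on UNIV)"

definition christoffel ::
  "(real ^ 'n::finite \<Rightarrow> real ^ 'n ^ 'n) \<Rightarrow> 'n \<Rightarrow> 'n \<Rightarrow> 'n \<Rightarrow> real ^ 'n \<Rightarrow> real" where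
  \<comment> \<open>\<open>christoffel g k i j\<close> is the symbol with upper index \<open>k\<close> and lower indices \<open>i\<close>, \<open>j\<close>\<close>
  "christoffel g k i j x =
     (\<Sum>l\<in>UNIV. matrix_inv (g x) $ k $ l *
        (pd i (\<lambda>y. g y $ j $ l) x + pd j (\<lambda>y. g y $ i $ l) x - pd l (\<lambda>y. g y $ i $ j) x)) / 2"

text \<open>
  Covariant tensors are families of component functions indexed by lists of coordinate indices;
  a function is a tensor whose only relevant index list is \<open>[]\<close>.  The covariant derivative puts
  the differentiation index first.
\<close>

fun cov_deriv :: "(real ^ 'n::finite \<Rightarrow> real ^ 'n ^ 'n) \<Rightarrow>
    ('n list \<Rightarrow> real ^ 'n \<Rightarrow> real) \<Rightarrow> 'n list \<Rightarrow> real ^ 'n \<Rightarrow> real" where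
  "cov_deriv g T [] x = 0"
| "cov_deriv g T (m # js) x = pd m (T js) x -
     (\<Sum>p<length js. \<Sum>q\<in>UNIV. christoffel g q m (js ! p) x * T (js[p := q]) x)"

definition hessian ::
  "(real ^ 'n::finite \<Rightarrow> real ^ 'n ^ 'n) \<Rightarrow> (real ^ 'n \<Rightarrow> real) \<Rightarrow> 'n \<Rightarrow> 'n \<Rightarrow> real ^ 'n \<Rightarrow> real" where
  "hessian g f i j = cov_deriv g (cov_deriv g (\<lambda>_. f)) [i, j]"

definition riemann_up ::
  "(real ^ 'n::finite \<Rightarrow> real ^ 'n ^ 'n) \<Rightarrow> 'n \<Rightarrow> 'n \<Rightarrow> 'n \<Rightarrow> 'n \<Rightarrow> real ^ 'n \<Rightarrow> real" where
  \<comment> \<open>the coefficient of the \<open>l\<close>-th coordinate field in \<open>R(\<partial>\<^sub>i, \<partial>\<^sub>j)\<partial>\<^sub>k\<close>\<close>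
  "riemann_up g l k i j x =
     pd i (christoffel g l j k) x - pd j (christoffel g l i k) x +
     (\<Sum>m\<in>UNIV. christoffel g l i m x * christoffel g m j k x
               - christoffel g l j m x * christoffel g m i k x)"

definition riemann ::
  "(real ^ 'n::finite \<Rightarrow> real ^ 'n ^ 'n) \<Rightarrow> 'n \<Rightarrow> 'n \<Rightarrow> 'n \<Rightarrow> 'n \<Rightarrow> real ^ 'n \<Rightarrow> real" where
  \<comment> \<open>sign convention: the sectional curvatures are the components of the form \<open>R\<^sub>1\<^sub>2\<^sub>1\<^sub>2\<close>\<close>
  "riemann g l k i j x = (\<Sum>m\<in>UNIV. g x $ l $ m * riemann_up g m k i j x)"

definition ricci ::
  "(real ^ 'n::finite \<Rightarrow> real ^ 'n ^ 'n) \<Rightarrow> 'n \<Rightarrow> 'n \<Rightarrow> real ^ 'n \<Rightarrow> real" where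
  "ricci g k j x = (\<Sum>i\<in>UNIV. riemann_up g i k i j x)"

definition scalar_curv :: "(real ^ 'n::finite \<Rightarrow> real ^ 'n ^ 'n) \<Rightarrow> real ^ 'n \<Rightarrow> real" where
  "scalar_curv g x = (\<Sum>i\<in>UNIV. \<Sum>j\<in>UNIV. matrix_inv (g x) $ i $ j * ricci g i j x)"

definition weyl ::
  "(real ^ 'n::finite \<Rightarrow> real ^ 'n ^ 'n) \<Rightarrow> 'n \<Rightarrow> 'n \<Rightarrow> 'n \<Rightarrow> 'n \<Rightarrow> real ^ 'n \<Rightarrow> real" where
  "weyl g l k i j x = (let n = real CARD('n) in
     riemann g l k i j x
     - (g x $ l $ i * ricci g k j x - g x $ l $ j * ricci g k i x
        + g x $ k $ j * ricci g l i x - g x $ k $ i * ricci g l j x) / (n - 2)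
     + scalar_curv g x * (g x $ l $ i * g x $ k $ j - g x $ l $ j * g x $ k $ i)
         / ((n - 1) * (n - 2)))"

definition weyl_tensor ::
  "(real ^ 'n::finite \<Rightarrow> real ^ 'n ^ 'n) \<Rightarrow> 'n list \<Rightarrow> real ^ 'n \<Rightarrow> real" where
  "weyl_tensor g js = (case js of [l, k, i, j] \<Rightarrow> weyl g l k i j | _ \<Rightarrow> (\<lambda>_. 0))"

text \<open>
  The Bach tensor in dimension four is, up to normalization,
  \<open>\<nabla>\<^sup>k \<nabla>\<^sup>l W\<^sub>i\<^sub>k\<^sub>j\<^sub>l + 1/2 R\<^sup>k\<^sup>l W\<^sub>i\<^sub>k\<^sub>j\<^sub>l\<close>.  The factor \<open>-2\<close> gives the normalization in which a product
  of two surfaces with constant scalar curvatures \<open>r\<^sub>1\<close>, \<open>r\<^sub>2\<close> has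
  \<open>B = - (r\<^sub>1\<^sup>2 - r\<^sub>2\<^sup>2) / 12 g\<^sub>1\<close> on the first factor and \<open>B = - (r\<^sub>2\<^sup>2 - r\<^sub>1\<^sup>2) / 12 g\<^sub>2\<close> on the second;
  in particular \<open>B\<close> is \<open>1/3\<close> of the metric on the flat factor of \<open>\<real>\<^sup>2 \<times> S\<^sup>2\<close> and \<open>-1/3\<close> of the
  metric on the sphere.
\<close>

definition bach :: "(real ^ 4 \<Rightarrow> real ^ 4 ^ 4) \<Rightarrow> 4 \<Rightarrow> 4 \<Rightarrow> real ^ 4 \<Rightarrow> real" where
  "bach g i j x = - 2 *
     ((\<Sum>k\<in>UNIV. \<Sum>l\<in>UNIV. \<Sum>a\<in>UNIV. \<Sum>b\<in>UNIV.
         matrix_inv (g x) $ k $ a * matrix_inv (g x) $ l $ b *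
           cov_deriv g (cov_deriv g (weyl_tensor g)) [a, b, i, k, j, l] x)
      + 1 / 2 * (\<Sum>k\<in>UNIV. \<Sum>l\<in>UNIV. \<Sum>a\<in>UNIV. \<Sum>b\<in>UNIV.
         matrix_inv (g x) $ k $ a * matrix_inv (g x) $ l $ b *
           ricci g a b x * weyl g i k j l x))"

definition dual_form ::
  "(real ^ 'n::finite \<Rightarrow> real ^ 'n ^ 'n) \<Rightarrow> (real ^ 'n \<Rightarrow> real ^ 'n) \<Rightarrow> 'n \<Rightarrow> real ^ 'n \<Rightarrow> real" where
  \<comment> \<open>components of the 1-form \<open>X \<mapsto> g(X, P)\<close>\<close>
  "dual_form g P i x = (\<Sum>j\<in>UNIV. g x $ i $ j * P x $ j)"

definition omega_bach ::
  "(real ^ 4 \<Rightarrow> real ^ 4 ^ 4) \<Rightarrow> real \<Rightarrow> (real ^ 4 \<Rightarrow> real ^ 4) \<Rightarrow> 4 \<Rightarrow> 4 \<Rightarrow> real ^ 4 \<Rightarrow> real" where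
  "omega_bach g \<beta> P i j x = bach g i j x - \<beta> * (dual_form g P i x * dual_form g P j x)"

definition gradient_omega_bach_soliton ::
  "(real ^ 4 \<Rightarrow> real ^ 4 ^ 4) \<Rightarrow> real \<Rightarrow> (real ^ 4 \<Rightarrow> real ^ 4) \<Rightarrow> real \<Rightarrow> (real ^ 4 \<Rightarrow> real) \<Rightarrow> bool"
  where
  "gradient_omega_bach_soliton g \<beta> P lam G \<longleftrightarrow>
     smooth_fun G \<and>
     (\<forall>x i j. hessian g G i j x + omega_bach g \<beta> P i j x = lam * g x $ i $ j)"

text \<open>
  The product metric on \<open>\<real>\<^sup>2 \<times> S\<^sup>2\<close> in the coordinates \<open>(s, t, u, v)\<close>, where \<open>(u, v)\<close> are stereographic
  coordinates on the unit sphere minus a pole.  Lemma \<open>metric_R2_S2_induced\<close> identifies the spherical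
  block with the induced metric.
\<close>

definition metric_R2_S2 :: "real ^ 4 \<Rightarrow> real ^ 4 ^ 4" where
  "metric_R2_S2 x = (\<chi> i j. if i \<noteq> j then 0
     else if i = 1 \<or> i = 2 then 1 else 4 / (1 + (x $ 3)\<^sup>2 + (x $ 4)\<^sup>2)\<^sup>2)"

definition stereo :: "real ^ 4 \<Rightarrow> real ^ 3" where
  \<comment> \<open>inverse stereographic projection from the north pole, applied to the last two coordinates\<close>
  "stereo x = (1 / (1 + (x $ 3)\<^sup>2 + (x $ 4)\<^sup>2)) *\<^sub>R
     vector [2 * x $ 3, 2 * x $ 4, (x $ 3)\<^sup>2 + (x $ 4)\<^sup>2 - 1]"

lemma vector_4 [simp]:
  "(vector [a, b, c, d] :: real ^ 4) $ 1 = a"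
  "(vector [a, b, c, d] :: real ^ 4) $ 2 = b"
  "(vector [a, b, c, d] :: real ^ 4) $ 3 = c"
  "(vector [a, b, c, d] :: real ^ 4) $ 4 = d"
  unfolding vector_def by simp_all

lemma stereo_component:
  "stereo x $ 1 = 2 * x $ 3 / (1 + (x $ 3)\<^sup>2 + (x $ 4)\<^sup>2)"
  "stereo x $ 2 = 2 * x $ 4 / (1 + (x $ 3)\<^sup>2 + (x $ 4)\<^sup>2)"
  "stereo x $ 3 = ((x $ 3)\<^sup>2 + (x $ 4)\<^sup>2 - 1) / (1 + (x $ 3)\<^sup>2 + (x $ 4)\<^sup>2)"
  by (simp_all add: stereo_def)

lemma stereo_denom_pos: "1 + a\<^sup>2 + b\<^sup>2 > (0 :: real)"
  by (simp add: add_pos_nonneg)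

lemma stereo_sphere: "norm (stereo x) = 1"
proof -
  define u v where "u = x $ 3" and "v = x $ 4"
  define q where "q = 1 + u\<^sup>2 + v\<^sup>2"
  have q: "q \<noteq> 0" using stereo_denom_pos[of u v] by (simp add: q_def)
  have "stereo x \<bullet> stereo x =
      (2 * u * (2 * u) + 2 * v * (2 * v) + (u\<^sup>2 + v\<^sup>2 - 1) * (u\<^sup>2 + v\<^sup>2 - 1)) / (q * q)"
    unfolding inner_vec_def sum_3 stereo_component u_def[symmetric] v_def[symmetric]
      q_def[symmetric] inner_real_def times_divide_times_eq add_divide_distrib[symmetric] ..
  also have "2 * u * (2 * u) + 2 * v * (2 * v) + (u\<^sup>2 + v\<^sup>2 - 1) * (u\<^sup>2 + v\<^sup>2 - 1) = q * q"
    by (simp add: q_def power2_eq_square algebra_simps)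
  finally show ?thesis using q by (simp add: norm_eq_sqrt_inner)
qed

lemma deriv_quotient:
  fixes N D :: "real \<Rightarrow> real"
  assumes "(N has_real_derivative n) (at 0)" "(D has_real_derivative d) (at 0)" "D 0 \<noteq> 0"
  shows "deriv (\<lambda>h. N h / D h) 0 = (n * D 0 - N 0 * d) / (D 0)\<^sup>2"
  using DERIV_divide[OF assms] by (simp add: DERIV_imp_deriv power2_eq_square)

lemma stereo_pd:
  fixes x :: "real ^ 4"
  defines "q \<equiv> 1 + (x $ 3)\<^sup>2 + (x $ 4)\<^sup>2"
  shows "pd 3 (\<lambda>y. stereo y $ 1) x = (2 * q - 4 * (x $ 3)\<^sup>2) / q\<^sup>2"
    and "pd 3 (\<lambda>y. stereo y $ 2) x = - 4 * x $ 3 * x $ 4 / q\<^sup>2"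
    and "pd 3 (\<lambda>y. stereo y $ 3) x = 4 * x $ 3 / q\<^sup>2"
    and "pd 4 (\<lambda>y. stereo y $ 1) x = - 4 * x $ 3 * x $ 4 / q\<^sup>2"
    and "pd 4 (\<lambda>y. stereo y $ 2) x = (2 * q - 4 * (x $ 4)\<^sup>2) / q\<^sup>2"
    and "pd 4 (\<lambda>y. stereo y $ 3) x = 4 * x $ 4 / q\<^sup>2"
proof -
  have q: "1 + (x $ 3)\<^sup>2 + (x $ 4)\<^sup>2 \<noteq> 0" using stereo_denom_pos[of "x $ 3" "x $ 4"] by simp
  have D3: "((\<lambda>h. 1 + (x $ 3 + h)\<^sup>2 + (x $ 4)\<^sup>2) has_real_derivative 2 * x $ 3) (at 0)"
    by (auto intro!: derivative_eq_intros)
  have D4: "((\<lambda>h. 1 + (x $ 3)\<^sup>2 + (x $ 4 + h)\<^sup>2) has_real_derivative 2 * x $ 4) (at 0)"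
    by (auto intro!: derivative_eq_intros)
  have N: "((\<lambda>h. 2 * (x $ 3 + h)) has_real_derivative 2) (at 0)"
    "((\<lambda>h. 2 * (x $ 4 + h)) has_real_derivative 2) (at 0)"
    "((\<lambda>h. 2 * x $ 3) has_real_derivative 0) (at 0)"
    "((\<lambda>h. 2 * x $ 4) has_real_derivative 0) (at 0)"
    "((\<lambda>h. (x $ 3 + h)\<^sup>2 + (x $ 4)\<^sup>2 - 1) has_real_derivative 2 * x $ 3) (at 0)"
    "((\<lambda>h. (x $ 3)\<^sup>2 + (x $ 4 + h)\<^sup>2 - 1) has_real_derivative 2 * x $ 4) (at 0)"
    by (auto intro!: derivative_eq_intros)
  show "pd 3 (\<lambda>y. stereo y $ 1) x = (2 * q - 4 * (x $ 3)\<^sup>2) / q\<^sup>2"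
    using deriv_quotient[OF N(1) D3] q
    by (simp add: pd_def stereo_component axis_def q_def power2_eq_square)
  show "pd 3 (\<lambda>y. stereo y $ 2) x = - 4 * x $ 3 * x $ 4 / q\<^sup>2"
    using deriv_quotient[OF N(4) D3] q
    by (simp add: pd_def stereo_component axis_def q_def mult_ac)
  show "pd 3 (\<lambda>y. stereo y $ 3) x = 4 * x $ 3 / q\<^sup>2"
    using deriv_quotient[OF N(5) D3] q
    by (simp add: pd_def stereo_component axis_def q_def algebra_simps)
  show "pd 4 (\<lambda>y. stereo y $ 1) x = - 4 * x $ 3 * x $ 4 / q\<^sup>2"
    using deriv_quotient[OF N(3) D4] q
    by (simp add: pd_def stereo_component axis_def q_def mult_ac)
  show "pd 4 (\<lambda>y. stereo y $ 2) x = (2 * q - 4 * (x $ 4)\<^sup>2) / q\<^sup>2"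
    using deriv_quotient[OF N(2) D4] q
    by (simp add: pd_def stereo_component axis_def q_def power2_eq_square)
  show "pd 4 (\<lambda>y. stereo y $ 3) x = 4 * x $ 4 / q\<^sup>2"
    using deriv_quotient[OF N(6) D4] q
    by (simp add: pd_def stereo_component axis_def q_def algebra_simps)
qed

lemma metric_R2_S2_induced:
  assumes "i \<in> {3, 4}" "j \<in> {3, 4}"
  shows "metric_R2_S2 x $ i $ j =
    (\<Sum>m\<in>UNIV. pd i (\<lambda>y. stereo y $ m) x * pd j (\<lambda>y. stereo y $ m) x)"
proof -
  define u v where "u = x $ 3" and "v = x $ 4"
  define q where "q = 1 + u\<^sup>2 + v\<^sup>2"
  have q: "q \<noteq> 0" using stereo_denom_pos[of u v] by (simp add: q_def)
  note p = stereo_pd[of x, folded u_def v_def, folded q_def]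
  have e: "4 / q\<^sup>2 = 4 * q\<^sup>2 / (q\<^sup>2 * q\<^sup>2)"
    by (rule nonzero_mult_divide_mult_cancel_right[symmetric]) (use q in simp)
  have a: "4 * q\<^sup>2 = (2 * q - 4 * u\<^sup>2) * (2 * q - 4 * u\<^sup>2) + (- 4 * u * v) * (- 4 * u * v) + 4 * u * (4 * u)"
    "4 * q\<^sup>2 = (- 4 * u * v) * (- 4 * u * v) + (2 * q - 4 * v\<^sup>2) * (2 * q - 4 * v\<^sup>2) + 4 * v * (4 * v)"
    "0 = (2 * q - 4 * u\<^sup>2) * (- 4 * u * v) + (- 4 * u * v) * (2 * q - 4 * v\<^sup>2) + 4 * u * (4 * v)"
    by (simp_all add: q_def power2_eq_square algebra_simps)
  have c: "(3 :: 4) \<noteq> 4" "(3 :: 4) \<noteq> 1" "(3 :: 4) \<noteq> 2" "(4 :: 4) \<noteq> 1" "(4 :: 4) \<noteq> 2" by simp_all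
  have m: "metric_R2_S2 x $ 3 $ 3 = 4 / q\<^sup>2" "metric_R2_S2 x $ 4 $ 4 = 4 / q\<^sup>2"
    "metric_R2_S2 x $ 3 $ 4 = 0" "metric_R2_S2 x $ 4 $ 3 = 0"
    using c by (simp_all add: metric_R2_S2_def q_def u_def v_def)
  have "metric_R2_S2 x $ 3 $ 3 = (\<Sum>m\<in>UNIV. pd 3 (\<lambda>y. stereo y $ m) x * pd 3 (\<lambda>y. stereo y $ m) x)"
    unfolding m sum_3 p e a(1) by (simp only: times_divide_times_eq add_divide_distrib)
  moreover have "metric_R2_S2 x $ 4 $ 4 = (\<Sum>m\<in>UNIV. pd 4 (\<lambda>y. stereo y $ m) x * pd 4 (\<lambda>y. stereo y $ m) x)"
    unfolding m sum_3 p e a(2) by (simp only: times_divide_times_eq add_divide_distrib)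
  moreover have o: "0 = (\<Sum>m\<in>UNIV. pd 3 (\<lambda>y. stereo y $ m) x * pd 4 (\<lambda>y. stereo y $ m) x)"
    unfolding sum_3 p times_divide_times_eq add_divide_distrib[symmetric] a(3)[symmetric] by simp
  moreover have "0 = (\<Sum>m\<in>UNIV. pd 4 (\<lambda>y. stereo y $ m) x * pd 3 (\<lambda>y. stereo y $ m) x)"
    using o by (simp only: mult.commute)
  ultimately show ?thesis using assms m by auto
qed

end

theory Submission
  imports Defs
begin

text \<open>
  The Weyl tensor of the product is a combination of products of the two parallel forms \<open>g\<^sup>R\<close> and
  \<open>g\<^sup>S\<close>, so the divergence term of the Bach tensor vanishes and the curvature term gives
  \<open>B = 1/3 g\<^sup>R - 1/3 g\<^sup>S\<close>.  On the sphere factor the soliton equation prescribes the second derivatives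
  of \<open>G\<close> in terms of the first ones.  Its integrability condition determines \<open>\<partial>\<^sub>u G\<close> and \<open>\<partial>\<^sub>v G\<close>,
  because the curvature of the sphere does not vanish, and the symmetry of the second derivatives
  then forces \<open>\<beta> P\<^sub>3 = \<beta> P\<^sub>4 = 0\<close>.  Hence \<open>G\<close> depends on \<open>s, t\<close> only, where its Hessian is constant.
\<close>

section \<open>Calculus of partial derivatives\<close>

text \<open>\<open>deriv\<close> returns an unspecified value where no derivative exists, so
  \<open>pd\<close> alone has no unconditional calculus. The relation carries existence along, and
  its rules chain by resolution.\<close>

definition has_pd :: "'n::finite \<Rightarrow> (real ^ 'n \<Rightarrow> real) \<Rightarrow> real \<Rightarrow> real ^ 'n \<Rightarrow> bool" where
  "has_pd i f D x \<longleftrightarrow> ((\<lambda>h. f (x + h *\<^sub>R axis i 1)) has_real_derivative D) (at 0)"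

lemma pd_eqI: "has_pd i f D x \<Longrightarrow> pd i f x = D"
  unfolding has_pd_def pd_def by (rule DERIV_imp_deriv)

text \<open>Lets the calculus rules build the derivative in a schematic variable; the comparison
  with the intended expression is left as the last goal.\<close>

lemma has_pd_cong: "has_pd i f D x \<Longrightarrow> D = D' \<Longrightarrow> has_pd i f D' x"
  by simp

lemma has_pd_const: "has_pd i (\<lambda>x. c) 0 x"
  unfolding has_pd_def by simp

lemma has_pd_component: "has_pd i (\<lambda>x. x $ j) (if i = j then 1 else 0) x"
  unfolding has_pd_def by (auto intro!: derivative_eq_intros simp: axis_def)

lemma has_pd_add: "has_pd i f D x \<Longrightarrow> has_pd i g E x \<Longrightarrow> has_pd i (\<lambda>x. f x + g x) (D + E) x"
  unfolding has_pd_def by (rule DERIV_add)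

lemma has_pd_diff: "has_pd i f D x \<Longrightarrow> has_pd i g E x \<Longrightarrow> has_pd i (\<lambda>x. f x - g x) (D - E) x"
  unfolding has_pd_def by (rule DERIV_diff)

lemma has_pd_mult:
  "has_pd i f D x \<Longrightarrow> has_pd i g E x \<Longrightarrow> has_pd i (\<lambda>x. f x * g x) (D * g x + f x * E) x"
  unfolding has_pd_def by (drule (1) DERIV_mult) (simp add: mult_ac)

lemma has_pd_cmult: "has_pd i f D x \<Longrightarrow> has_pd i (\<lambda>x. c * f x) (c * D) x"
  unfolding has_pd_def by (rule DERIV_cmult)

lemma has_pd_power2: "has_pd i f D x \<Longrightarrow> has_pd i (\<lambda>x. (f x)\<^sup>2) (2 * f x * D) x"
  unfolding has_pd_def by (drule DERIV_power[where n = 2]) (simp add: mult_ac)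

lemma has_pd_inverse:
  "has_pd i f D x \<Longrightarrow> f x \<noteq> 0 \<Longrightarrow> has_pd i (\<lambda>x. inverse (f x)) (- D * (inverse (f x))\<^sup>2) x"
  unfolding has_pd_def by (drule DERIV_inverse_fun) (auto simp: power2_eq_square mult_ac)

text \<open>The chain rule along a coordinate line gives the total derivative on the basis vectors;
  linearity does the rest.\<close>

lemma has_derivative_pd:
  fixes f :: "real ^ 'n::finite \<Rightarrow> real"
  assumes "f differentiable_on UNIV"
  shows "(f has_derivative (\<lambda>v. \<Sum>i\<in>UNIV. v $ i * pd i f x)) (at x)"
proof -
  obtain f' where f': "(f has_derivative f') (at x)"
    using assms unfolding differentiable_on_def differentiable_def by auto
  interpret f': bounded_linear f' using f' by (rule has_derivative_bounded_linear)
  have pd: "pd i f x = f' (axis i 1)" for i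
  proof -
    have "((\<lambda>h. x + h *\<^sub>R axis i (1::real)) has_derivative (\<lambda>h. h *\<^sub>R axis i 1)) (at 0)"
      by (auto intro!: derivative_eq_intros)
    then have "((\<lambda>h. f (x + h *\<^sub>R axis i 1)) has_derivative (\<lambda>h. f' (h *\<^sub>R axis i 1))) (at 0)"
      by (rule has_derivative_compose) (simp add: f')
    moreover have "(\<lambda>h. f' (h *\<^sub>R axis i 1)) = (*) (f' (axis i 1))"
      by (auto simp: f'.scaleR mult.commute)
    ultimately show ?thesis
      by (simp add: pd_def has_field_derivative_def DERIV_imp_deriv)
  qed
  have "f' v = (\<Sum>i\<in>UNIV. v $ i * pd i f x)" for v
  proof -
    have "f' v = f' (\<Sum>i\<in>UNIV. v $ i *\<^sub>R axis i 1)"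
      by (metis (no_types) basis_expansion scalar_mult_eq_scaleR)
    then show ?thesis by (simp add: f'.sum f'.scaleR pd)
  qed
  then have "f' = (\<lambda>v. \<Sum>i\<in>UNIV. v $ i * pd i f x)" by auto
  with f' show ?thesis by simp
qed

text \<open>The parameter \<open>t\<close> is arbitrary because the mean value theorem needs the
  derivative along a whole segment.\<close>

lemma differentiable_has_pd_along:
  assumes "f differentiable_on UNIV"
  shows "((\<lambda>h. f (x + h *\<^sub>R axis i 1)) has_real_derivative pd i f (x + t *\<^sub>R axis i 1)) (at t)"
proof -
  let ?y = "x + t *\<^sub>R axis i 1"
  have "((\<lambda>h. x + h *\<^sub>R axis i (1::real)) has_derivative (\<lambda>h. h *\<^sub>R axis i 1)) (at t)"
    by (auto intro!: derivative_eq_intros)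
  then have "((\<lambda>h. f (x + h *\<^sub>R axis i 1)) has_derivative
      (\<lambda>h. \<Sum>k\<in>UNIV. (h *\<^sub>R axis i 1) $ k * pd k f ?y)) (at t)"
    by (rule has_derivative_compose) (rule has_derivative_pd[OF assms])
  moreover have "(\<Sum>k\<in>UNIV. (h *\<^sub>R axis i 1) $ k * pd k f ?y)
      = (\<Sum>k\<in>UNIV. if k = i then pd i f ?y * h else 0)" for h
    by (rule sum.cong) (auto simp: axis_def)
  ultimately show ?thesis
    by (simp add: has_field_derivative_def lambda_one)
qed

lemma differentiable_has_pd: "f differentiable_on UNIV \<Longrightarrow> has_pd i f (pd i f x) x"
  using differentiable_has_pd_along[of f x i 0] by (simp add: has_pd_def)

lemma pd_zero_imp_constant:
  fixes f :: "real ^ 'n::finite \<Rightarrow> real"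
  assumes "f differentiable_on UNIV" "\<And>i x. pd i f x = 0"
  shows "f x = f y"
proof -
  have "(f has_derivative (\<lambda>_. 0)) (at x within UNIV)" for x
    using has_derivative_pd[OF assms(1), of x] by (simp add: assms(2))
  then obtain c where "\<And>x. f x = c"
    using has_derivative_zero_constant[of UNIV f] by auto
  then show ?thesis by simp
qed

text \<open>The mean value theorem twice: along \<open>i\<close> for the difference across the step
  in direction \<open>j\<close>, then along \<open>j\<close> for \<open>pd i f\<close>.\<close>

lemma second_difference:
  fixes f :: "real ^ 'n::finite \<Rightarrow> real"
  assumes f: "f differentiable_on UNIV" and fi: "pd i f differentiable_on UNIV" and h: "0 < h"
  obtains r s where "0 < r" "r < h" "0 < s" "s < h"
    "f (x + h *\<^sub>R axis i 1 + h *\<^sub>R axis j 1) - f (x + h *\<^sub>R axis i 1) - f (x + h *\<^sub>R axis j 1) + f x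
      = h\<^sup>2 * pd j (pd i f) (x + r *\<^sub>R axis i 1 + s *\<^sub>R axis j 1)"
proof -
  define F where "F r = f (x + h *\<^sub>R axis j 1 + r *\<^sub>R axis i 1) - f (x + r *\<^sub>R axis i 1)" for r
  have "DERIV F r :> pd i f (x + h *\<^sub>R axis j 1 + r *\<^sub>R axis i 1) - pd i f (x + r *\<^sub>R axis i 1)" for r
    unfolding F_def by (intro DERIV_diff differentiable_has_pd_along f)
  from MVT2[OF h this] obtain r where r: "0 < r" "r < h" and Fr:
    "F h - F 0 = (h - 0) * (pd i f (x + h *\<^sub>R axis j 1 + r *\<^sub>R axis i 1) - pd i f (x + r *\<^sub>R axis i 1))"
    by blast
  define z where "z = x + r *\<^sub>R axis i (1::real)"
  have dz: "DERIV (\<lambda>s. pd i f (z + s *\<^sub>R axis j 1)) s :> pd j (pd i f) (z + s *\<^sub>R axis j 1)" for s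
    by (intro differentiable_has_pd_along fi)
  from MVT2[OF h dz] obtain s where s: "0 < s" "s < h" and
    "pd i f (z + h *\<^sub>R axis j 1) - pd i f (z + 0 *\<^sub>R axis j 1)
       = (h - 0) * pd j (pd i f) (z + s *\<^sub>R axis j 1)"
    by blast
  then have "F h - F 0 = h\<^sup>2 * pd j (pd i f) (x + r *\<^sub>R axis i 1 + s *\<^sub>R axis j 1)"
    unfolding Fr z_def by (simp add: power2_eq_square algebra_simps)
  then show thesis using that[OF r s] by (simp add: F_def algebra_simps)
qed

text \<open>Schwarz's theorem. The second difference is symmetric in \<open>i\<close> and
  \<open>j\<close>, so \<open>second_difference\<close> equates a value of one mixed derivative near
  \<open>x\<close> with a value of the other near \<open>x\<close>; continuity then excludes a gap
  at \<open>x\<close>.\<close>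

lemma pd_commute:
  fixes f :: "real ^ 'n::finite \<Rightarrow> real"
  assumes f: "f differentiable_on UNIV"
    and fi: "pd i f differentiable_on UNIV" and fj: "pd j f differentiable_on UNIV"
    and cij: "continuous_on UNIV (pd i (pd j f))" and cji: "continuous_on UNIV (pd j (pd i f))"
  shows "pd i (pd j f) x = pd j (pd i f) x"
proof (rule ccontr)
  assume neq: "\<not> ?thesis"
  define e where "e = \<bar>pd i (pd j f) x - pd j (pd i f) x\<bar> / 2"
  have e: "e > 0" using neq by (simp add: e_def)
  obtain d1 where d1: "d1 > 0" "\<And>y. dist y x < d1 \<Longrightarrow> \<bar>pd i (pd j f) y - pd i (pd j f) x\<bar> < e"
    using cij e unfolding continuous_on_iff by (metis UNIV_I dist_real_def)
  obtain d2 where d2: "d2 > 0" "\<And>y. dist y x < d2 \<Longrightarrow> \<bar>pd j (pd i f) y - pd j (pd i f) x\<bar> < e"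
    using cji e unfolding continuous_on_iff by (metis UNIV_I dist_real_def)
  \<comment> \<open>The points are displaced by less than \<open>h\<close> along each of two axes;
    halving keeps them inside both balls.\<close>
  define h where "h = min d1 d2 / 2"
  have h: "0 < h" "2 * h \<le> d1" "2 * h \<le> d2" using d1(1) d2(1) by (simp_all add: h_def)
  have near: "dist (x + r *\<^sub>R axis k 1 + s *\<^sub>R axis l 1) x < 2 * h"
    if "0 < r" "r < h" "0 < s" "s < h" for r s and k l :: 'n
  proof -
    have "dist (x + r *\<^sub>R axis k 1 + s *\<^sub>R axis l 1) x
        = norm (r *\<^sub>R axis k (1::real) + s *\<^sub>R axis l 1 :: real ^ 'n)"
      by (simp add: dist_norm add.assoc)
    also have "\<dots> \<le> norm (r *\<^sub>R axis k (1::real) :: real ^ 'n) + norm (s *\<^sub>R axis l 1 :: real ^ 'n)"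
      by (rule norm_triangle_ineq)
    finally show ?thesis using that by simp
  qed
  let ?D = "f (x + h *\<^sub>R axis i 1 + h *\<^sub>R axis j 1) - f (x + h *\<^sub>R axis i 1)
    - f (x + h *\<^sub>R axis j 1) + f x"
  obtain r s where rs: "0 < r" "r < h" "0 < s" "s < h"
    and D1: "?D = h\<^sup>2 * pd j (pd i f) (x + r *\<^sub>R axis i 1 + s *\<^sub>R axis j 1)"
    using second_difference[OF f fi h(1), of x j] by blast
  obtain r' s' where rs': "0 < r'" "r' < h" "0 < s'" "s' < h"
    and "f (x + h *\<^sub>R axis j 1 + h *\<^sub>R axis i 1) - f (x + h *\<^sub>R axis j 1)
      - f (x + h *\<^sub>R axis i 1) + f x = h\<^sup>2 * pd i (pd j f) (x + r' *\<^sub>R axis j 1 + s' *\<^sub>R axis i 1)"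
    using second_difference[OF f fj h(1), of x i] by blast
  then have D2: "?D = h\<^sup>2 * pd i (pd j f) (x + r' *\<^sub>R axis j 1 + s' *\<^sub>R axis i 1)"
    by (simp add: algebra_simps)
  have "pd j (pd i f) (x + r *\<^sub>R axis i 1 + s *\<^sub>R axis j 1)
      = pd i (pd j f) (x + r' *\<^sub>R axis j 1 + s' *\<^sub>R axis i 1)"
    using D1 D2 h(1) by simp
  moreover have "\<bar>pd i (pd j f) (x + r' *\<^sub>R axis j 1 + s' *\<^sub>R axis i 1) - pd i (pd j f) x\<bar> < e"
    using d1(2) near[OF rs', of j i] h by force
  moreover have "\<bar>pd j (pd i f) (x + r *\<^sub>R axis i 1 + s *\<^sub>R axis j 1) - pd j (pd i f) x\<bar> < e"
    using d2(2) near[OF rs, of i j] h by force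
  moreover have "\<bar>a - b\<bar> \<le> \<bar>c - a\<bar> + \<bar>c - b\<bar>" for a b c :: real
    by linarith
  ultimately show False unfolding e_def by (metis add_strict_mono field_sum_of_halves not_le)
qed

lemma smooth_fun_differentiable: "smooth_fun f \<Longrightarrow> f differentiable_on UNIV"
  unfolding smooth_fun_def by (metis foldr.simps(1) id_apply)

lemma smooth_fun_pd: "smooth_fun f \<Longrightarrow> smooth_fun (pd i f)"
  unfolding smooth_fun_def
proof
  fix ms assume "\<forall>ms. foldr pd ms f differentiable_on UNIV"
  \<comment> \<open>\<open>foldr\<close> applies the last index of the list first, so the appended
    \<open>i\<close> acts on \<open>f\<close> before \<open>ms\<close>.\<close>
  then have "foldr pd (ms @ [i]) f differentiable_on UNIV" by blast
  then show "foldr pd ms (pd i f) differentiable_on UNIV" by simp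
qed

lemma smooth_fun_pd_commute: "smooth_fun f \<Longrightarrow> pd i (pd j f) x = pd j (pd i f) x"
  by (intro pd_commute differentiable_imp_continuous_on smooth_fun_differentiable smooth_fun_pd)

section \<open>Parallel tensors\<close>

text \<open>Vanishing of the covariant derivative, solved for the partial derivative. Stated with
  \<open>has_pd\<close>, it also supplies the differentiability that the product rule
  requires.\<close>

definition parallel2 ::
  "(real ^ 'n::finite \<Rightarrow> real ^ 'n ^ 'n) \<Rightarrow> ('n \<Rightarrow> 'n \<Rightarrow> real ^ 'n \<Rightarrow> real) \<Rightarrow> bool" where
  "parallel2 g H \<longleftrightarrow> (\<forall>m i j x. has_pd m (H i j)
     ((\<Sum>q\<in>UNIV. christoffel g q m i x * H q j x) + (\<Sum>q\<in>UNIV. christoffel g q m j x * H i q x)) x)"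

definition parallel4 ::
  "(real ^ 'n::finite \<Rightarrow> real ^ 'n ^ 'n) \<Rightarrow> ('n \<Rightarrow> 'n \<Rightarrow> 'n \<Rightarrow> 'n \<Rightarrow> real ^ 'n \<Rightarrow> real) \<Rightarrow> bool" where
  "parallel4 g T \<longleftrightarrow> (\<forall>m l k i j x. has_pd m (T l k i j)
     ((\<Sum>q\<in>UNIV. christoffel g q m l x * T q k i j x) + (\<Sum>q\<in>UNIV. christoffel g q m k x * T l q i j x)
      + (\<Sum>q\<in>UNIV. christoffel g q m i x * T l k q j x)
      + (\<Sum>q\<in>UNIV. christoffel g q m j x * T l k i q x)) x)"

lemma parallel4_add:
  assumes "parallel4 g S" "parallel4 g T"
  shows "parallel4 g (\<lambda>l k i j x. S l k i j x + T l k i j x)"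
  unfolding parallel4_def
  by (intro allI, rule has_pd_cong[OF has_pd_add[OF assms[unfolded parallel4_def, rule_format]]])
    (simp add: distrib_left sum.distrib)

lemma parallel4_cmult:
  assumes "parallel4 g T"
  shows "parallel4 g (\<lambda>l k i j x. c * T l k i j x)"
  unfolding parallel4_def
  by (intro allI, rule has_pd_cong[OF has_pd_cmult[OF assms[unfolded parallel4_def, rule_format]]])
    (simp add: distrib_left sum_distrib_left mult.left_commute[of _ c])

text \<open>Leibniz rule, for the two index patterns that occur in the Weyl tensor of the
  product.\<close>

lemma parallel4_product:
  assumes H: "parallel2 g H" and K: "parallel2 g K"
  shows "parallel4 g (\<lambda>l k i j x. H l i x * K k j x)"
    and "parallel4 g (\<lambda>l k i j x. H l j x * K k i x)"
  unfolding parallel4_def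
  by (intro allI, rule has_pd_cong[OF has_pd_mult[OF H[unfolded parallel2_def, rule_format]
          K[unfolded parallel2_def, rule_format]]],
      simp add: distrib_left distrib_right sum_distrib_left sum_distrib_right mult.assoc
        mult.left_commute)+

lemma cov_deriv_zero: "cov_deriv g (\<lambda>_ _. 0) = (\<lambda>_ _. 0)"
proof (intro ext)
  show "cov_deriv g (\<lambda>_ _. 0) js x = 0" for js x
    by (cases js) (simp_all add: pd_eqI[OF has_pd_const])
qed

text \<open>An equality of functions on index lists of every length, so that a second covariant
  derivative becomes that of the zero tensor.\<close>

lemma cov_deriv_parallel4:
  assumes "parallel4 g T"
  shows "cov_deriv g (\<lambda>js. case js of [l, k, i, j] \<Rightarrow> T l k i j | _ \<Rightarrow> (\<lambda>_. 0)) = (\<lambda>_ _. 0)"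
    (is "cov_deriv g ?T = _")
proof (intro ext)
  fix js x
  have other: "?T js = (\<lambda>_. 0)" if "length js \<noteq> 4" for js
    using that by (auto split: list.split)
  show "cov_deriv g ?T js x = 0"
  proof (cases js)
    case (Cons m ks)
    show ?thesis
    proof (cases "length ks = 4")
      case False
      then show ?thesis using other by (simp add: Cons pd_eqI[OF has_pd_const])
    next
      case True
      then obtain l k i j where ks: "ks = [l, k, i, j]"
        by (auto simp: eval_nat_numeral length_Suc_conv)
      have "pd m (T l k i j) x = (\<Sum>q\<in>UNIV. christoffel g q m l x * T q k i j x)
        + (\<Sum>q\<in>UNIV. christoffel g q m k x * T l q i j x)
        + (\<Sum>q\<in>UNIV. christoffel g q m i x * T l k q j x)
        + (\<Sum>q\<in>UNIV. christoffel g q m j x * T l k i q x)"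
        using assms unfolding parallel4_def by (intro pd_eqI) blast
      then show ?thesis
        by (simp add: Cons ks eval_nat_numeral lessThan_Suc)
    qed
  qed simp
qed

lemma hessian_eq:
  "hessian g f i j x = pd i (pd j f) x - (\<Sum>q\<in>UNIV. christoffel g q i j x * pd q f x)"
proof -
  have "cov_deriv g (\<lambda>_. f) [k] = pd k f" for k
    by (intro ext) simp
  then show ?thesis unfolding hessian_def by simp
qed

section \<open>Curvature of the product metric\<close>

text \<open>A real weight in place of a case distinction keeps the tensor formulas uniform in the
  indices; they are then verified by expanding over all indices.\<close>

definition sph :: "4 \<Rightarrow> real" where
  "sph i = (if i = 3 \<or> i = 4 then 1 else 0)"

text \<open>The conformal factor of the round metric in stereographic coordinates, written with
  \<open>inverse\<close> to suit \<open>has_pd_inverse\<close>.\<close>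

definition cfactor :: "real ^ 4 \<Rightarrow> real" where
  "cfactor x = 4 * (inverse (1 + (x $ 3)\<^sup>2 + (x $ 4)\<^sup>2))\<^sup>2"

text \<open>The partial derivatives of half the logarithm of \<open>cfactor\<close>.\<close>

definition logd :: "4 \<Rightarrow> real ^ 4 \<Rightarrow> real" where
  "logd i x = sph i * (- 2 * x $ i * inverse (1 + (x $ 3)\<^sup>2 + (x $ 4)\<^sup>2))"

definition kron :: "4 \<Rightarrow> 4 \<Rightarrow> real" where
  "kron i j = (if i = j then 1 else 0)"

text \<open>This form and \<open>sphere_part\<close> are the pullbacks of the two factor metrics to
  the product.\<close>

definition flat_part :: "4 \<Rightarrow> 4 \<Rightarrow> real ^ 4 \<Rightarrow> real" where
  "flat_part i j x = kron i j * (1 - sph i)"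

definition sphere_part :: "4 \<Rightarrow> 4 \<Rightarrow> real ^ 4 \<Rightarrow> real" where
  "sphere_part i j x = kron i j * sph i * cfactor x"

lemmas [simp] = stereo_denom_pos[THEN less_imp_neq, symmetric]

lemma sph_simps [simp]: "sph 1 = 0" "sph 2 = 0" "sph 3 = 1" "sph 4 = 1"
  by (simp_all add: sph_def)

lemma kron_simps [simp]: "kron i i = 1" "i \<noteq> j \<Longrightarrow> kron i j = 0"
  by (simp_all add: kron_def)

lemma logd_flat [simp]: "logd 1 x = 0" "logd 2 x = 0"
  by (simp_all add: logd_def)

lemma cfactor_pos: "cfactor x > 0"
  using stereo_denom_pos[of "x $ 3" "x $ 4"] by (simp add: cfactor_def)

lemma cfactor_nz [simp]: "cfactor x \<noteq> 0" using cfactor_pos[of x] by simp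

lemma metric_eq: "metric_R2_S2 x $ i $ j = flat_part i j x + sphere_part i j x"
  using exhaust_4[of i]
  by (auto simp: metric_R2_S2_def flat_part_def sphere_part_def cfactor_def kron_def sph_def
      divide_simps)

text \<open>\<open>matrix_inv\<close> is a choice among two-sided inverses, and these are
  unique.\<close>

lemma matrix_inv_unique:
  fixes A :: "'a::semiring_1 ^ 'n ^ 'm"
  assumes "A ** B = mat 1" "B ** A = mat 1"
  shows "matrix_inv A = B"
proof -
  have "A ** matrix_inv A = mat 1 \<and> matrix_inv A ** A = mat 1"
    unfolding matrix_inv_def by (rule someI) (use assms in blast)
  then show ?thesis
    by (metis assms(1) matrix_mul_assoc matrix_mul_lid matrix_mul_rid)
qed

lemma matrix_inv_diagonal:
  fixes d :: "'n::finite \<Rightarrow> real"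
  assumes "\<And>i. d i \<noteq> 0"
  shows "matrix_inv (\<chi> i j. if i = j then d i else 0) = (\<chi> i j. if i = j then inverse (d i) else 0)"
    (is "matrix_inv ?A = ?B")
proof (rule matrix_inv_unique)
  have "(\<Sum>k\<in>UNIV. (if i = k then a i else 0) * (if k = j then b k else 0))
      = (if i = j then 1 else 0)" if "\<And>i. a i * b i = 1" for a b :: "'n \<Rightarrow> real" and i j
  proof -
    have "(\<Sum>k\<in>UNIV. (if i = k then a i else 0) * (if k = j then b k else 0))
        = (\<Sum>k\<in>UNIV. if k = i then (if i = j then 1 else 0) else 0)"
      by (rule sum.cong) (auto simp: that)
    then show ?thesis by simp
  qed
  from this[of d "\<lambda>i. inverse (d i)"] this[of "\<lambda>i. inverse (d i)" d]
  show "?A ** ?B = mat 1" "?B ** ?A = mat 1"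
    using assms by (simp_all add: matrix_matrix_mult_def mat_def vec_eq_iff)
qed

lemma metric_inv_eq:
  "matrix_inv (metric_R2_S2 x) $ i $ j = kron i j * (1 - sph i + sph i * inverse (cfactor x))"
proof -
  have "metric_R2_S2 x = (\<chi> i j. if i = j then 1 - sph i + sph i * cfactor x else 0)"
    by (simp add: vec_eq_iff metric_eq flat_part_def sphere_part_def kron_def)
  moreover have "1 - sph i + sph i * cfactor x \<noteq> 0" for i
    by (simp add: sph_def)
  ultimately show ?thesis
    using matrix_inv_diagonal[of "\<lambda>i. 1 - sph i + sph i * cfactor x"]
    by (simp add: kron_def sph_def)
qed

section \<open>Derivatives of the metric and its Christoffel symbols\<close>

lemma has_pd_denom:
  "has_pd m (\<lambda>x. 1 + (x $ 3)\<^sup>2 + (x $ 4)\<^sup>2) (sph m * (2 * x $ m)) x"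
  by (rule has_pd_cong, (rule has_pd_add has_pd_const has_pd_power2 has_pd_component)+)
    (use exhaust_4[of m] in auto)

lemma has_pd_cfactor: "has_pd m cfactor (2 * cfactor x * logd m x) x"
  unfolding cfactor_def[abs_def] logd_def
  by (rule has_pd_cong, (rule has_pd_cmult has_pd_power2 has_pd_inverse has_pd_denom)+)
    (simp, simp add: power2_eq_square mult_ac)

lemma has_pd_logd:
  "has_pd m (logd i) (sph m * sph i * (- kron m i * 2 * inverse (1 + (x $ 3)\<^sup>2 + (x $ 4)\<^sup>2))
     + logd m x * logd i x) x"
proof -
  have "has_pd m (\<lambda>x. sph i * (- 2 * (x $ i * inverse (1 + (x $ 3)\<^sup>2 + (x $ 4)\<^sup>2))))
    (sph m * sph i * (- kron m i * 2 * inverse (1 + (x $ 3)\<^sup>2 + (x $ 4)\<^sup>2))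
     + logd m x * logd i x) x"
    by (rule has_pd_cong, (rule has_pd_cmult has_pd_mult has_pd_component has_pd_inverse
        has_pd_denom)+)
      (simp, auto simp: kron_def logd_def sph_def power2_eq_square mult_ac)
  then show ?thesis unfolding logd_def[abs_def] by (simp add: mult_ac)
qed

lemma has_pd_metric:
  "has_pd m (\<lambda>y. metric_R2_S2 y $ i $ j) (kron i j * sph i * (2 * cfactor x * logd m x)) x"
  unfolding metric_eq flat_part_def sphere_part_def
  by (rule has_pd_cong, (rule has_pd_add has_pd_const has_pd_cmult has_pd_cfactor)+) simp

text \<open>The classical symbols of a conformally flat metric, on the sphere block; a flat index
  makes them vanish because the flat block is constant and \<open>cfactor\<close> does not depend on
  \<open>s\<close> and \<open>t\<close>.\<close>

lemma christoffel_R2_S2: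
  "christoffel metric_R2_S2 k i j x = sph i * sph j * sph k *
     (kron k i * logd j x + kron k j * logd i x - kron i j * logd k x)"
proof -
  have "\<forall>k i j. christoffel metric_R2_S2 k i j x = sph i * sph j * sph k *
     (kron k i * logd j x + kron k j * logd i x - kron i j * logd k x)"
    unfolding christoffel_def pd_eqI[OF has_pd_metric] metric_inv_eq sum_4 forall_4
    by (simp add: mult_ac)
  then show ?thesis by blast
qed

lemma parallel_flat_part: "parallel2 metric_R2_S2 flat_part"
proof -
  have "\<forall>i j m. 0 = (\<Sum>q\<in>UNIV. christoffel metric_R2_S2 q m i x * flat_part q j x)
    + (\<Sum>q\<in>UNIV. christoffel metric_R2_S2 q m j x * flat_part i q x)" for x
    unfolding christoffel_R2_S2 flat_part_def sum_4 forall_4 by simp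
  moreover have "has_pd m (flat_part i j) 0 x" for m i j x
    unfolding flat_part_def[abs_def] by (rule has_pd_const)
  ultimately show ?thesis unfolding parallel2_def by metis
qed

lemma parallel_sphere_part: "parallel2 metric_R2_S2 sphere_part"
proof -
  have eq: "\<forall>i j m. kron i j * sph i * (2 * cfactor x * logd m x)
    = (\<Sum>q\<in>UNIV. christoffel metric_R2_S2 q m i x * sphere_part q j x)
    + (\<Sum>q\<in>UNIV. christoffel metric_R2_S2 q m j x * sphere_part i q x)" for x
    unfolding christoffel_R2_S2 sphere_part_def sum_4 forall_4 by simp
  have "has_pd m (sphere_part i j) (kron i j * sph i * (2 * cfactor x * logd m x)) x"
    for m i j x
    unfolding sphere_part_def[abs_def] by (intro has_pd_cmult has_pd_cfactor)
  then show ?thesis unfolding parallel2_def eq[rule_format, symmetric] by blast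
qed

text \<open>With \<open>c\<close> the inverse of \<open>1 + u\<^sup>2 + v\<^sup>2\<close>, the right
  side is \<open>4 * c\<^sup>2 * (1 + u\<^sup>2 + v\<^sup>2)\<close>.\<close>

lemma logd_norm:
  "4 * inverse (1 + (x $ 3)\<^sup>2 + (x $ 4)\<^sup>2) = cfactor x + (logd 3 x)\<^sup>2 + (logd 4 x)\<^sup>2"
proof -
  have "4 * c = 4 * c\<^sup>2 + (- 2 * u * c)\<^sup>2 + (- 2 * v * c)\<^sup>2"
    if "c * (1 + u\<^sup>2 + v\<^sup>2) = 1" for c u v :: real
    using that by algebra
  from this[of "inverse (1 + (x $ 3)\<^sup>2 + (x $ 4)\<^sup>2)" "x $ 3" "x $ 4"]
  show ?thesis by (simp add: cfactor_def logd_def)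
qed

text \<open>By \<open>logd_norm\<close>, \<open>logdd m i\<close> is the partial derivative of \<open>logd i\<close>; in this form the curvature
  identities become polynomial in \<open>logd\<close> and \<open>cfactor\<close>.\<close>

definition logdd :: "4 \<Rightarrow> 4 \<Rightarrow> real ^ 4 \<Rightarrow> real" where
  "logdd m i x = logd m x * logd i x
     - sph m * sph i * kron m i * (cfactor x + (logd 3 x)\<^sup>2 + (logd 4 x)\<^sup>2) / 2"

lemma has_pd_logd_normalized: "has_pd m (logd i) (logdd m i x) x"
  unfolding logdd_def logd_norm[symmetric]
  by (rule has_pd_cong[OF has_pd_logd]) simp

lemma has_pd_christoffel:
  "has_pd m (christoffel metric_R2_S2 k i j) (sph i * sph j * sph k *
     (kron k i * logdd m j x + kron k j * logdd m i x - kron i j * logdd m k x)) x"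
  unfolding christoffel_R2_S2[abs_def]
  by (intro has_pd_cmult has_pd_diff has_pd_add has_pd_logd_normalized)

section \<open>Curvature tensors, from Riemann to Bach\<close>

lemma logd_sph: "sph i = 0 \<Longrightarrow> logd i x = 0"
  by (simp add: logd_def)

lemma sph_cases: "sph i = 0 \<or> i = 3 \<or> i = 4"
  by (simp add: sph_def)

text \<open>The form of constant curvature 1 on the sphere factor: the terms quadratic in
  \<open>logd\<close> cancel, and the \<open>cfactor\<close> inside \<open>logdd\<close>
  remains.\<close>

lemma riemann_up_R2_S2:
  "riemann_up metric_R2_S2 l k i j x
     = sph l * (kron l i * sphere_part k j x - kron l j * sphere_part k i x)"
proof -
  \<comment> \<open>A flat index annihilates the symbols and their derivatives, so one common weight
    factors out and the inner sum runs over 3 and 4 only.\<close>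
  have eq: "riemann_up metric_R2_S2 l k i j x
     = sph l * sph k * sph i * sph j *
        (kron l j * logdd i k x + kron l k * logdd i j x - kron j k * logdd i l x
        - (kron l i * logdd j k x + kron l k * logdd j i x - kron i k * logdd j l x)
        + (\<Sum>m\<in>{3, 4}.
            (kron l i * logd m x + kron l m * logd i x - kron i m * logd l x)
             * (kron m j * logd k x + kron m k * logd j x - kron j k * logd m x)
          - (kron l j * logd m x + kron l m * logd j x - kron j m * logd l x)
             * (kron m i * logd k x + kron m k * logd i x - kron i k * logd m x)))"
    unfolding riemann_up_def pd_eqI[OF has_pd_christoffel] christoffel_R2_S2 sum_4
    by (cases "sph l = 0"; cases "sph k = 0"; cases "sph i = 0"; cases "sph j = 0")
      (simp_all add: logdd_def logd_sph sph_def split: if_splits)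
  consider "sph l = 0" | "sph k = 0" | "sph i = 0" | "sph j = 0"
    | "l \<in> {3, 4}" "k \<in> {3, 4}" "i \<in> {3, 4}" "j \<in> {3, 4}"
    using sph_cases by blast
  then show ?thesis
  proof cases
    case 5
    then show ?thesis unfolding eq
      by (elim insertE emptyE)
        (simp_all add: logdd_def sphere_part_def power2_eq_square algebra_simps)
  qed (auto simp: eq sphere_part_def kron_def)
qed

lemma ricci_R2_S2: "ricci metric_R2_S2 k j x = sphere_part k j x"
proof -
  have "\<forall>k j. ricci metric_R2_S2 k j x = sphere_part k j x"
    unfolding ricci_def riemann_up_R2_S2 sphere_part_def sum_4 forall_4 by simp
  then show ?thesis by blast
qed

lemma scalar_curv_R2_S2: "scalar_curv metric_R2_S2 x = 2"
  unfolding scalar_curv_def ricci_R2_S2 metric_inv_eq sphere_part_def sum_4 by simp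

lemma riemann_R2_S2:
  "riemann metric_R2_S2 l k i j x
     = sphere_part l i x * sphere_part k j x - sphere_part l j x * sphere_part k i x"
proof -
  \<comment> \<open>The metric is diagonal, so only \<open>m = l\<close> survives. Its coefficient
    may be written \<open>cfactor x\<close> for every \<open>l\<close>, since
    \<open>riemann_up\<close> vanishes for flat \<open>l\<close>.\<close>
  have "riemann metric_R2_S2 l k i j x
      = (\<Sum>m\<in>UNIV. if m = l then cfactor x * riemann_up metric_R2_S2 l k i j x else 0)"
    unfolding riemann_def
    by (rule sum.cong)
      (auto simp: metric_eq riemann_up_R2_S2 flat_part_def sphere_part_def kron_def sph_def)
  then show ?thesis by (simp add: riemann_up_R2_S2 sphere_part_def algebra_simps)
qed

text \<open>Dimension 4 and scalar curvature 2 give the coefficients 1 - 1 + 1/3 (sphere-sphere),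
  1/3 (flat-flat) and -1/2 + 1/3 (mixed). Signs are kept inside the scalars so that
  \<open>parallel4_add\<close> and \<open>parallel4_cmult\<close> match.\<close>

lemma weyl_R2_S2:
  "weyl metric_R2_S2 l k i j x =
     1 / 3 * (sphere_part l i x * sphere_part k j x) + - 1 / 3 * (sphere_part l j x * sphere_part k i x)
     + 1 / 3 * (flat_part l i x * flat_part k j x) + - 1 / 3 * (flat_part l j x * flat_part k i x)
     + - 1 / 6 * (flat_part l i x * sphere_part k j x) + 1 / 6 * (flat_part l j x * sphere_part k i x)
     + - 1 / 6 * (sphere_part l i x * flat_part k j x) + 1 / 6 * (sphere_part l j x * flat_part k i x)"
  unfolding weyl_def riemann_R2_S2 ricci_R2_S2 scalar_curv_R2_S2 metric_eq
  by (simp add: field_simps)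

lemma parallel_weyl: "parallel4 metric_R2_S2 (weyl metric_R2_S2)"
  unfolding weyl_R2_S2[abs_def]
  by (intro parallel4_add parallel4_cmult parallel4_product parallel_sphere_part parallel_flat_part)

text \<open>Contracting Ricci with both inverse metrics first leaves two nonzero entries, so the
  curvature term of \<open>bach\<close> has two summands.\<close>

lemma ricci_raised:
  "(\<Sum>a\<in>UNIV. \<Sum>b\<in>UNIV. matrix_inv (metric_R2_S2 x) $ k $ a * matrix_inv (metric_R2_S2 x) $ l $ b *
      ricci metric_R2_S2 a b x) = kron k l * sph k * inverse (cfactor x)"
proof -
  have "\<forall>k l. (\<Sum>a\<in>UNIV. \<Sum>b\<in>UNIV. matrix_inv (metric_R2_S2 x) $ k $ a *
      matrix_inv (metric_R2_S2 x) $ l $ b * ricci metric_R2_S2 a b x)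
      = kron k l * sph k * inverse (cfactor x)"
    unfolding ricci_R2_S2 metric_inv_eq sphere_part_def sum_4 forall_4 by simp
  then show ?thesis by blast
qed

lemma bach_R2_S2:
  "bach metric_R2_S2 i j x = 1 / 3 * flat_part i j x - 1 / 3 * sphere_part i j x"
proof -
  have W: "cov_deriv metric_R2_S2 (cov_deriv metric_R2_S2 (weyl_tensor metric_R2_S2)) = (\<lambda>_ _. 0)"
    unfolding weyl_tensor_def cov_deriv_parallel4[OF parallel_weyl] by (rule cov_deriv_zero)
  \<comment> \<open>The divergence term is gone, and the factors -2 and 1/2 combine to -1.\<close>
  have "bach metric_R2_S2 i j x
      = - (\<Sum>k\<in>UNIV. \<Sum>l\<in>UNIV. kron k l * sph k * inverse (cfactor x) * weyl metric_R2_S2 i k j l x)"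
    unfolding bach_def W ricci_raised[symmetric] sum_distrib_right by simp
  also have "\<dots> = - inverse (cfactor x) * (weyl metric_R2_S2 i 3 j 3 x + weyl metric_R2_S2 i 4 j 4 x)"
    by (simp add: sum_4 algebra_simps)
  also have "\<dots> = 1 / 3 * flat_part i j x - 1 / 3 * sphere_part i j x"
  proof -
    have "\<forall>i j. - inverse (cfactor x) * (weyl metric_R2_S2 i 3 j 3 x + weyl metric_R2_S2 i 4 j 4 x)
        = 1 / 3 * flat_part i j x - 1 / 3 * sphere_part i j x"
      unfolding weyl_R2_S2 flat_part_def sphere_part_def forall_4 by (simp add: field_simps)
    then show ?thesis by blast
  qed
  finally show ?thesis .
qed

section \<open>Solitons\<close>

lemma dual_form_R2_S2:
  "dual_form metric_R2_S2 P i x = (1 - sph i + sph i * cfactor x) * P x $ i"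
proof -
  have "dual_form metric_R2_S2 P i x
      = (\<Sum>j\<in>UNIV. if j = i then (1 - sph i + sph i * cfactor x) * P x $ i else 0)"
    unfolding dual_form_def
    by (rule sum.cong) (auto simp: metric_eq flat_part_def sphere_part_def kron_def)
  then show ?thesis by simp
qed

text \<open>The soliton equation solved for the second derivatives; \<open>lam - 1 / 3\<close> and
  \<open>lam + 1 / 3\<close> are \<open>lam\<close> minus the Bach eigenvalue of each
  factor.\<close>

lemma soliton_second_pd:
  assumes "gradient_omega_bach_soliton metric_R2_S2 \<beta> P lam G"
  shows "pd i (pd j G) x = sph i * sph j *
      (logd j x * pd i G x + logd i x * pd j G x
        - kron i j * (logd 3 x * pd 3 G x + logd 4 x * pd 4 G x))
    + (lam - 1 / 3) * flat_part i j x + (lam + 1 / 3) * sphere_part i j x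
    + \<beta> * ((1 - sph i + sph i * cfactor x) * P x $ i * ((1 - sph j + sph j * cfactor x) * P x $ j))"
proof -
  have christoffel: "\<forall>i j. (\<Sum>q\<in>UNIV. christoffel metric_R2_S2 q i j x * pd q G x) = sph i * sph j *
      (logd j x * pd i G x + logd i x * pd j G x
        - kron i j * (logd 3 x * pd 3 G x + logd 4 x * pd 4 G x))"
    unfolding christoffel_R2_S2 sum_4 forall_4 by (simp add: algebra_simps)
  have "hessian metric_R2_S2 G i j x + omega_bach metric_R2_S2 \<beta> P i j x
      = lam * metric_R2_S2 x $ i $ j"
    using assms unfolding gradient_omega_bach_soliton_def by blast
  then show ?thesis
    unfolding hessian_eq christoffel[rule_format] omega_bach_def dual_form_R2_S2 bach_R2_S2
      metric_eq
    by (simp add: algebra_simps)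
qed

text \<open>Commuting \<open>pd 3\<close> and \<open>pd 4\<close> on \<open>pd k G\<close> expresses the first derivatives of \<open>G\<close> on the
  sphere through the data: the curvature 1 of the sphere appears as the coefficient of \<open>pd k G\<close>.\<close>

lemma soliton_sphere_pd:
  fixes \<beta> lam :: real and P :: "real ^ 4"
  assumes sol: "gradient_omega_bach_soliton metric_R2_S2 \<beta> (\<lambda>_. P) lam G"
  shows "pd 3 G x = \<beta> * cfactor x *
      (4 * (P $ 3 * P $ 4) * logd 4 x + ((P $ 3)\<^sup>2 - 3 * (P $ 4)\<^sup>2) * logd 3 x)" (is ?th3)
    and "pd 4 G x = \<beta> * cfactor x *
      (4 * (P $ 3 * P $ 4) * logd 3 x + ((P $ 4)\<^sup>2 - 3 * (P $ 3)\<^sup>2) * logd 4 x)" (is ?th4)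
proof -
  have G: "smooth_fun G" using sol by (simp add: gradient_omega_bach_soliton_def)
  define a b p q f where "a = pd 3 G" "b = pd 4 G" "p = logd 3" "q = logd 4" "f = cfactor"
  note defs = this
  \<comment> \<open>\<open>A\<close>, \<open>B\<close> and \<open>C\<close> are the prescribed
    \<open>(3,3)\<close>, \<open>(4,4)\<close> and mixed derivatives. Since they involve only
    \<open>a\<close>, \<open>b\<close>, \<open>p\<close>, \<open>q\<close> and \<open>f\<close>,
    whose derivatives are known, they can be differentiated again.\<close>
  define A where "A = (\<lambda>x. p x * a x - q x * b x + (lam + 1 / 3) * f x + \<beta> * (P $ 3)\<^sup>2 * (f x)\<^sup>2)"
  define B where "B = (\<lambda>x. q x * b x - p x * a x + (lam + 1 / 3) * f x + \<beta> * (P $ 4)\<^sup>2 * (f x)\<^sup>2)"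
  define C where "C = (\<lambda>x. q x * a x + p x * b x + \<beta> * (P $ 3 * P $ 4) * (f x)\<^sup>2)"
  have pd: "pd 3 a = A" "pd 4 b = B" "pd 3 b = C" "pd 4 a = C"
    unfolding A_def B_def C_def defs
    by (intro ext, simp add: soliton_second_pd[OF sol] flat_part_def sphere_part_def
        power2_eq_square algebra_simps)+
  have diff: "a differentiable_on UNIV" "b differentiable_on UNIV"
    unfolding defs by (intro smooth_fun_differentiable smooth_fun_pd G)+
  note ab = diff[THEN differentiable_has_pd, of 3, unfolded pd]
    diff[THEN differentiable_has_pd, of 4, unfolded pd]
  have r: "has_pd m p (logdd m 3 x) x" "has_pd m q (logdd m 4 x) x"
      "has_pd m f (2 * f x * logd m x) x" for m x
    unfolding defs by (rule has_pd_logd_normalized has_pd_cfactor)+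
  note rules = has_pd_add has_pd_diff has_pd_cmult has_pd_mult has_pd_power2 r ab
  have ld: "logdd 3 3 x = (p x)\<^sup>2 - (f x + (p x)\<^sup>2 + (q x)\<^sup>2) / 2" "logdd 3 4 x = p x * q x"
    "logdd 4 3 x = p x * q x" "logdd 4 4 x = (q x)\<^sup>2 - (f x + (p x)\<^sup>2 + (q x)\<^sup>2) / 2"
    by (simp_all add: logdd_def defs power2_eq_square)
  have l: "logd 3 x = p x" "logd 4 x = q x" by (simp_all add: defs)
  have A4: "pd 4 A x = p x * q x * a x + p x * C x
      - ((q x)\<^sup>2 - (f x + (p x)\<^sup>2 + (q x)\<^sup>2) / 2) * b x - q x * B x
      + (lam + 1 / 3) * (2 * f x * q x) + \<beta> * (P $ 3)\<^sup>2 * (2 * f x * (2 * f x * q x))"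
    unfolding A_def by (rule pd_eqI, rule has_pd_cong, (rule rules)+) (simp add: ld l algebra_simps)
  have C3: "pd 3 C x = p x * q x * a x + q x * A x
      + ((p x)\<^sup>2 - (f x + (p x)\<^sup>2 + (q x)\<^sup>2) / 2) * b x + p x * C x
      + \<beta> * (P $ 3 * P $ 4) * (2 * f x * (2 * f x * p x))"
    unfolding C_def
    by (rule pd_eqI, rule has_pd_cong, (rule rules)+) (simp add: ld l C_def algebra_simps)
  have B3: "pd 3 B x = p x * q x * b x + q x * C x
      - ((p x)\<^sup>2 - (f x + (p x)\<^sup>2 + (q x)\<^sup>2) / 2) * a x - p x * A x
      + (lam + 1 / 3) * (2 * f x * p x) + \<beta> * (P $ 4)\<^sup>2 * (2 * f x * (2 * f x * p x))"
    unfolding B_def by (rule pd_eqI, rule has_pd_cong, (rule rules)+) (simp add: ld l algebra_simps)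
  have C4: "pd 4 C x = ((q x)\<^sup>2 - (f x + (p x)\<^sup>2 + (q x)\<^sup>2) / 2) * a x + q x * C x
      + p x * q x * b x + p x * B x
      + \<beta> * (P $ 3 * P $ 4) * (2 * f x * (2 * f x * q x))"
    unfolding C_def
    by (rule pd_eqI, rule has_pd_cong, (rule rules)+) (simp add: ld l C_def algebra_simps)
  \<comment> \<open>Here \<open>A\<close> and \<open>C\<close> are the derivatives of
    \<open>a\<close>, and \<open>C\<close> and \<open>B\<close> those of \<open>b\<close>.\<close>
  have "pd 4 A x = pd 3 C x" "pd 3 B x = pd 4 C x"
    using smooth_fun_pd_commute[OF smooth_fun_pd[OF G, of 3], of 4 3 x]
      smooth_fun_pd_commute[OF smooth_fun_pd[OF G, of 4], of 3 4 x]
    by (simp_all add: pd flip: defs)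
  \<comment> \<open>The terms with \<open>lam\<close> cancel, and so do the first derivatives with
    coefficients quadratic in \<open>p\<close> and \<open>q\<close>; the \<open>f\<close> in
    \<open>logdd\<close> leaves \<open>f x\<close> times one first derivative, and \<open>f\<close>
    has no zero.\<close>
  then have "f x * b x = f x * (\<beta> * f x * (4 * (P $ 3 * P $ 4) * p x + ((P $ 4)\<^sup>2 - 3 * (P $ 3)\<^sup>2) * q x))"
    "f x * a x = f x * (\<beta> * f x * (4 * (P $ 3 * P $ 4) * q x + ((P $ 3)\<^sup>2 - 3 * (P $ 4)\<^sup>2) * p x))"
    unfolding A4 C3 B3 C4 unfolding A_def B_def by (simp_all add: field_simps power2_eq_square)
  then show ?th3 ?th4
    by (simp_all add: defs)
qed

text \<open>The gradient found in \<open>soliton_sphere_pd\<close> must itself have symmetric second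
  derivatives; two points of the chart suffice to exploit this.\<close>

lemma soliton_sphere_field_zero:
  fixes \<beta> lam :: real and P :: "real ^ 4"
  assumes sol: "gradient_omega_bach_soliton metric_R2_S2 \<beta> (\<lambda>_. P) lam G"
  shows "\<beta> * P $ 3 = 0" "\<beta> * P $ 4 = 0"
proof -
  have G: "smooth_fun G" using sol by (simp add: gradient_omega_bach_soliton_def)
  define K where "K = \<beta> * (P $ 3 * P $ 4)"
  define M where "M = \<beta> * (P $ 3)\<^sup>2 - 3 * \<beta> * (P $ 4)\<^sup>2"
  define N where "N = \<beta> * (P $ 4)\<^sup>2 - 3 * \<beta> * (P $ 3)\<^sup>2"
  have G3: "pd 3 G = (\<lambda>x. cfactor x * (4 * K * logd 4 x + M * logd 3 x))"
    and G4: "pd 4 G = (\<lambda>x. cfactor x * (4 * K * logd 3 x + N * logd 4 x))"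
    unfolding K_def M_def N_def
    by (simp_all add: fun_eq_iff soliton_sphere_pd[OF sol] algebra_simps)
  have eq: "4 * K * (logd 4 x)\<^sup>2 + M * (logd 3 x * logd 4 x)
      = 4 * K * (logd 3 x)\<^sup>2 + N * (logd 3 x * logd 4 x)" for x
  proof -
    note rules = has_pd_add has_pd_cmult has_pd_mult has_pd_logd_normalized has_pd_cfactor
    have "pd 4 (pd 3 G) x = 2 * cfactor x * logd 4 x * (4 * K * logd 4 x + M * logd 3 x)
        + cfactor x * (4 * K * logdd 4 4 x + M * logdd 4 3 x)"
      unfolding G3 by (rule pd_eqI) (intro rules)
    moreover have "pd 3 (pd 4 G) x = 2 * cfactor x * logd 3 x * (4 * K * logd 3 x + N * logd 4 x)
        + cfactor x * (4 * K * logdd 3 3 x + N * logdd 3 4 x)"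
      unfolding G4 by (rule pd_eqI) (intro rules)
    ultimately have "cfactor x * (2 * (logd 4 x * (4 * K * logd 4 x + M * logd 3 x))
        + (4 * K * logdd 4 4 x + M * logdd 4 3 x))
      = cfactor x * (2 * (logd 3 x * (4 * K * logd 3 x + N * logd 4 x))
        + (4 * K * logdd 3 3 x + N * logdd 3 4 x))"
      using smooth_fun_pd_commute[OF G, of 4 3 x] by (simp add: algebra_simps)
    then have "2 * (logd 4 x * (4 * K * logd 4 x + M * logd 3 x))
        + (4 * K * logdd 4 4 x + M * logdd 4 3 x)
      = 2 * (logd 3 x * (4 * K * logd 3 x + N * logd 4 x))
        + (4 * K * logdd 3 3 x + N * logdd 3 4 x)"
      by simp
    \<comment> \<open>The brackets inside \<open>logdd 3 3 x\<close> and \<open>logdd 4 4 x\<close>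
      agree and cancel; all other terms share a factor 3.\<close>
    then show ?thesis
      by (simp add: logdd_def power2_eq_square algebra_simps)
  qed
  \<comment> \<open>At the first point \<open>logd 4\<close> is zero and \<open>logd 3\<close> is
    not. At the second, below, both are equal and nonzero, which leaves
    \<open>M = N\<close>.\<close>
  have "K = 0" using eq[of "vector [0, 0, 1, 0]"] by (simp add: logd_def)
  moreover have "M = N"
    using eq[of "vector [0, 0, 1, 1]"] by (simp add: logd_def)
  ultimately have "\<beta> * (P $ 3 * P $ 4) = 0" "\<beta> * (P $ 3)\<^sup>2 = \<beta> * (P $ 4)\<^sup>2"
    by (simp_all add: K_def M_def N_def)
  \<comment> \<open>If \<open>\<beta> \<noteq> 0\<close>, one of the two components is zero and
    their squares agree, so both vanish.\<close>
  then show "\<beta> * P $ 3 = 0" "\<beta> * P $ 4 = 0" by auto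
qed

theorem theorem4p3:
  fixes \<beta> lam P1 P2 P3 P4 :: real and G :: "real ^ 4 \<Rightarrow> real"
  assumes "gradient_omega_bach_soliton metric_R2_S2 \<beta> (\<lambda>_. vector [P1, P2, P3, P4]) lam G"
  shows "(\<exists>c1 c2 c. \<forall>s t u v. G (vector [s, t, u, v]) =
            1 / 2 * ((lam - 1 / 3) + \<beta> * P1\<^sup>2) * s\<^sup>2
            + 1 / 2 * ((lam - 1 / 3) + \<beta> * P2\<^sup>2) * t\<^sup>2
            + \<beta> * P1 * P2 * s * t + c1 * s + c2 * t
            + \<beta> * P3\<^sup>2 / 2 * (1 + u\<^sup>2 + v\<^sup>2)\<^sup>2 + c)
         \<and> (\<beta> \<noteq> 0 \<longrightarrow> P3\<^sup>2 = P4\<^sup>2)"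
proof -
  note sol = assms
  have G: "smooth_fun G" using sol by (simp add: gradient_omega_bach_soliton_def)
  have zero: "\<beta> * P3 = 0" "\<beta> * P4 = 0"
    using soliton_sphere_field_zero[OF sol] by simp_all
  then have zz: "\<beta> = 0 \<or> P3 = 0" "\<beta> = 0 \<or> P4 = 0" by auto
  define k1 k2 m where "k1 = (lam - 1 / 3) + \<beta> * P1\<^sup>2" "k2 = (lam - 1 / 3) + \<beta> * P2\<^sup>2"
    "m = \<beta> * P1 * P2"
  note defs = this
  \<comment> \<open>Derivatives mixing the two factors carry \<open>\<beta> * P3\<close> or
    \<open>\<beta> * P4\<close>, hence vanish by \<open>zz\<close>.\<close>
  have pd1: "pd i (pd 1 G) x = (if i = 1 then k1 else if i = 2 then m else 0)" for i x
    using exhaust_4[of i] zz unfolding soliton_second_pd[OF sol] defs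
    by (auto simp: flat_part_def sphere_part_def power2_eq_square)
  have pd2: "pd i (pd 2 G) x = (if i = 1 then m else if i = 2 then k2 else 0)" for i x
    using exhaust_4[of i] zz unfolding soliton_second_pd[OF sol] defs
    by (auto simp: flat_part_def sphere_part_def power2_eq_square)
  have pd34: "pd 3 G x = 0" "pd 4 G x = 0" for x
    using zz unfolding soliton_sphere_pd[OF sol] by auto
  have cd: "(\<lambda>x :: real ^ 4. x $ j) differentiable_on UNIV" for j
    by (intro linear_imp_differentiable_on bounded_linear.linear bounded_linear_vec_nth)
  note hp = differentiable_has_pd[OF smooth_fun_differentiable]
  note dints = differentiable_on_diff differentiable_on_add differentiable_on_mult
    differentiable_on_const cd smooth_fun_differentiable smooth_fun_pd G
  define c1 c2 c where "c1 = pd 1 G 0" "c2 = pd 2 G 0" "c = G 0"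
  have grad1: "pd 1 G x = k1 * x $ 1 + m * x $ 2 + c1" for x
  proof -
    \<comment> \<open>Subtracting the candidate leaves a function with zero gradient, which equals
      its value at the origin.\<close>
    let ?F = "\<lambda>x. pd 1 G x - (k1 * x $ 1 + m * x $ 2)"
    have "?F x = ?F 0"
    proof (rule pd_zero_imp_constant[where f = ?F])
      show "?F differentiable_on UNIV" by (intro dints)
      show "pd i ?F x = 0" for i x
        by (rule pd_eqI, rule has_pd_cong,
            (rule hp[OF smooth_fun_pd[OF G]] has_pd_diff has_pd_add has_pd_cmult has_pd_component)+)
          (use exhaust_4[of i] in \<open>auto simp: pd1\<close>)
    qed
    then show ?thesis by (simp add: c1_c2_c_def)
  qed
  have grad2: "pd 2 G x = m * x $ 1 + k2 * x $ 2 + c2" for x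
  proof -
    let ?F = "\<lambda>x. pd 2 G x - (m * x $ 1 + k2 * x $ 2)"
    have "?F x = ?F 0"
    proof (rule pd_zero_imp_constant[where f = ?F])
      show "?F differentiable_on UNIV" by (intro dints)
      show "pd i ?F x = 0" for i x
        by (rule pd_eqI, rule has_pd_cong,
            (rule hp[OF smooth_fun_pd[OF G]] has_pd_diff has_pd_add has_pd_cmult has_pd_component)+)
          (use exhaust_4[of i] in \<open>auto simp: pd2\<close>)
    qed
    then show ?thesis by (simp add: c1_c2_c_def)
  qed
  \<comment> \<open>Squares are written as products to fit the product rules in \<open>dints\<close>
    and for \<open>has_pd\<close>.\<close>
  let ?Q = "\<lambda>x :: real ^ 4. 1 / 2 * k1 * (x $ 1 * x $ 1) + 1 / 2 * k2 * (x $ 2 * x $ 2)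
    + m * (x $ 1 * x $ 2) + c1 * x $ 1 + c2 * x $ 2"
  have "G x = ?Q x + c" for x
  proof -
    have "G x - ?Q x = G 0 - ?Q 0"
    proof (rule pd_zero_imp_constant[where f = "\<lambda>x. G x - ?Q x"])
      show "(\<lambda>x. G x - ?Q x) differentiable_on UNIV" by (intro dints)
      show "pd i (\<lambda>x. G x - ?Q x) x = 0" for i x
        by (rule pd_eqI, rule has_pd_cong,
            (rule hp[OF G] has_pd_diff has_pd_add has_pd_cmult has_pd_component has_pd_mult)+)
          (use exhaust_4[of i] in \<open>auto simp: grad1 grad2 pd34\<close>)
    qed
    then show ?thesis by (simp add: \<open>c = G 0\<close>)
  qed
  \<comment> \<open>This makes the spherical term of the claimed formula zero, in agreement with
    \<open>pd34\<close>.\<close>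
  moreover have "\<beta> * P3\<^sup>2 = 0" using zz by auto
  ultimately have "\<forall>s t u v. G (vector [s, t, u, v]) =
            1 / 2 * ((lam - 1 / 3) + \<beta> * P1\<^sup>2) * s\<^sup>2
            + 1 / 2 * ((lam - 1 / 3) + \<beta> * P2\<^sup>2) * t\<^sup>2
            + \<beta> * P1 * P2 * s * t + c1 * s + c2 * t
            + \<beta> * P3\<^sup>2 / 2 * (1 + u\<^sup>2 + v\<^sup>2)\<^sup>2 + c"
    by (simp add: defs power2_eq_square)
  \<comment> \<open>For \<open>\<beta> \<noteq> 0\<close> both squares are zero; for
    \<open>\<beta> = 0\<close> the soliton equation does not constrain \<open>P\<close>.\<close>
  moreover have "\<beta> \<noteq> 0 \<longrightarrow> P3\<^sup>2 = P4\<^sup>2" using zz by auto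
  ultimately show ?thesis by blast
qed

end
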